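(* For any locally simple document theory $\mathcal{T}$ and any constant lists $model$, $queue$, there is a terminating chase sequence for $\langle model, queue\rangle$ with respect to $\mathcal{T}$.
   Context: Setting: the language of Semantic Modeling, a two-sorted first-order language (sorts "urelement" and "list") interpreted in hereditarily finite list superstructures; lists are built from urelement constants and $\langle\ \rangle$ using ${\tt cons}$ (append a new last element), ${\tt conc}$, ${\tt head}$ (last element), ${\tt tail}$ (all but the last element); bounded quantifiers; extended with conditional terms ${\tt Cond}$, search terms ${\tt bSearch}$ and bounded-recursion terms ${\tt Rec}$ (recursion along initial segments of a list). Natural number $n$ = list of $n$ empty lists. Document terms are list terms built additionally from arithmetic operations and accessors to the latest ID, to documents by ID, and to field values in a model. A document theory $\mathcal{T}$ is given over pairwise disjoint finite sets $FieldNames$, $FormNames$ (non-empty), $FilterNames$, $TransNames$ of constants. Fields are lists (head = field name, tail = value), documents are lists of fields. $\mathcal{T}$ specifies cardinality restrictions on field values, a blank document with default values for each form, and filters $GetDocsByFilter_{name}(fName, model, params)$ returning IDs of last versions of documents of form $fName$ in $model$ satisfying a Boolean combination of $<,=$ comparisons of document terms. Instructions: $\langle formName, CreateDoc\rangle$, $\langle value, fieldName, docID, SetField\rangle$, transactions $\langle params, docID, transName\rangle$. A model is a list of tuples $\langle sit, form, doc, ID\rangle$; a queue is a list of instructions. $Update(initialmodel, model, queue)$ processes the first instruction: empty queue returns $model$; invalid instruction returns $initialmodel$; CreateDoc appends a blank document of that form with a fresh ID (the next natural number after the largest ID) and removes the instruction; SetField (if the field exists in the document and the value respects the cardinality; otherwise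 return $initialmodel$) appends a new version of the document with updated value and replaces the remaining queue by $SetFieldTrigger(docID, fieldName, value, {\tt tail}(queue), model)$; a transaction keeps the model and replaces the remaining queue by $ExecTrans(transName, docID, params, {\tt tail}(queue), model)$; then recursion. The daemons $SetFieldTrigger$, $ExecTrans$ are ${\tt Cond}[\theta_1,q_1]\dots[\theta_n,q_n][queue]$ terms. Conditions of $SetFieldTrigger$ are $(formName, fieldName)$-conditions ("document $docID$ has form $formName$, the changed field is $fieldName$, and $\varphi$"); conditions of $ExecTrans$ are $(formName, transName)$-conditions ("document $docID$ has form $formName$, the transaction is $transName$, and $\varphi$"), $\varphi$ a Boolean combination of comparisons of document terms. Each $q_i={\tt conc}(queue, instr_i)$, the queue extension $instr_i$ being a concatenation of instruction terms: a single SetField instruction on field $fieldName'$ of document $docID$ (a $(formName, fieldName')$-instruction, $formName$ being the form in $\theta_i$); a ${\tt Rec}$-term emitting, for every ID in the result of a filter applied to form $frmName$, a transaction with name $transName$ (a $(frmName, transName)$-instruction); and, only in $ExecTrans$, a single $\langle frmName, CreateDoc\rangle$ or one $\langle frmName, CreateDoc\rangle$ per ID of a filter result on form $frmName$ (a $(frmName, CreateDoc)$-instruction). Chase: $\langle model, queue\rangle\mapsto\langle model', queue'\rangle$ denotes one non-recursive unfolding step of $Update$ on the first instruction of a non-empty queue. A chase sequence is a sequence of such steps; it is terminating if it is finite, $s_0,\dots,s_k$ with $k\ge1$, and $s_k=\langle m_k,\langle\ \rangle\rangle$. Dependency graph of $\mathcal{T}$: directed graph with vertices $FormNames\times(FieldNames\cup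 TransNames\cup\{CreateDoc\})$ and an edge from $(form, name)$ to $(form', name')$ iff some branch $[\theta, q]$ of $SetFieldTrigger$ or $ExecTrans$ has $\theta$ a $(form,name)$-condition and $q={\tt conc}(queue, instr)$ where $instr$ contains a $(form', name')$-instruction. $\mathcal{T}$ is locally simple if its dependency graph is acyclic.
   Formalization: The queue is assumed non-empty: a chase step needs a non-empty queue and a terminating chase sequence needs at least one step, so the claim as worded fails for the empty queue. *)

theory Defs
  imports Main "HOL-Library.Extended_Nat" "HOL-Library.Sublist"
begin

section \<open>Hereditarily finite lists over urelements\<close>

text \<open>A list is written in its usual order, so the element appended last by \<open>cons\<close>
  is the last one of the Isabelle list. Objects of sort list are given by \<open>Lst\<close>; where
  only that sort makes sense (models, queues) the type \<open>'u obj list\<close> is used directly.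
  The list functions are total: an urelement in a place that requires a list is read as
  the empty list.\<close>

datatype 'u obj = Ur 'u | Lst "'u obj list"

abbreviation nil :: "'u obj" where "nil \<equiv> Lst []"

primrec elems :: "'u obj \<Rightarrow> 'u obj list" where
  "elems (Ur a) = []"
| "elems (Lst xs) = xs"

primrec is_list :: "'u obj \<Rightarrow> bool" where
  "is_list (Ur a) = False"
| "is_list (Lst xs) = True"

definition hcons :: "'u obj \<Rightarrow> 'u obj \<Rightarrow> 'u obj" where
  "hcons l x = Lst (elems l @ [x])"

definition hconc :: "'u obj \<Rightarrow> 'u obj \<Rightarrow> 'u obj" where
  "hconc l l' = Lst (elems l @ elems l')"

definition hhead :: "'u obj \<Rightarrow> 'u obj" where
  "hhead l = (if elems l = [] then nil else last (elems l))"

definition htail :: "'u obj \<Rightarrow> 'u obj" where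
  "htail l = Lst (butlast (elems l))"

definition init_seg :: "'u obj \<Rightarrow> 'u obj \<Rightarrow> bool" where
  "init_seg l l' \<longleftrightarrow> is_list l \<and> is_list l' \<and> prefix (elems l) (elems l')"

definition num :: "nat \<Rightarrow> 'u obj" where
  "num n = Lst (replicate n nil)"

definition is_num :: "'u obj \<Rightarrow> bool" where
  "is_num x \<longleftrightarrow> x \<in> range num"

definition num_less :: "'u obj \<Rightarrow> 'u obj \<Rightarrow> bool" where
  "num_less x y \<longleftrightarrow> (\<exists>m n. x = num m \<and> y = num n \<and> m < n)"

definition num_op :: "(nat \<Rightarrow> nat \<Rightarrow> nat) \<Rightarrow> 'u obj \<Rightarrow> 'u obj \<Rightarrow> 'u obj" where
  "num_op f x y =
     (if is_num x \<and> is_num y then num (f (length (elems x)) (length (elems y))) else nil)"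


section \<open>Access to models\<close>

text \<open>A model lists document versions \<open>\<langle>sit, form, doc, ID\<rangle>\<close>, the most recent one last.
  Since arbitrary lists have to be accepted as models, elements of any other shape are
  ignored. A field is \<open>cons(value, name)\<close>.\<close>

fun entry_of :: "'u obj \<Rightarrow> ('u obj \<times> 'u obj \<times> 'u obj \<times> 'u obj) option" where
  "entry_of (Lst [s, f, d, i]) = Some (s, f, d, i)"
| "entry_of _ = None"

definition entries :: "'u obj list \<Rightarrow> ('u obj \<times> 'u obj \<times> 'u obj \<times> 'u obj) list" where
  "entries m = List.map_filter entry_of m"

definition last_version ::
  "'u obj list \<Rightarrow> 'u obj \<Rightarrow> ('u obj \<times> 'u obj \<times> 'u obj \<times> 'u obj) option" where
  "last_version m i = find (\<lambda>(s, f, d, j). j = i) (rev (entries m))"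

definition form_of :: "'u obj list \<Rightarrow> 'u obj \<Rightarrow> 'u obj option" where
  "form_of m i = map_option (\<lambda>(s, f, d, j). f) (last_version m i)"

definition doc_of :: "'u obj list \<Rightarrow> 'u obj \<Rightarrow> 'u obj option" where
  "doc_of m i = map_option (\<lambda>(s, f, d, j). d) (last_version m i)"

definition doc_ids :: "'u obj list \<Rightarrow> 'u obj list" where
  "doc_ids m = remdups (map (\<lambda>(s, f, d, j). j) (entries m))"

text \<open>The largest natural number occurring as an ID, and 0 if there is none.\<close>

definition latest_id :: "'u obj list \<Rightarrow> nat" where
  "latest_id m = Max (insert 0 {n. num n \<in> set (doc_ids m)})"

definition find_field :: "'u obj \<Rightarrow> 'u obj \<Rightarrow> 'u obj option" where
  "find_field d name = find (\<lambda>fl. hhead fl = name) (elems d)"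

definition field_value :: "'u obj \<Rightarrow> 'u obj \<Rightarrow> 'u obj list \<Rightarrow> 'u obj" where
  "field_value name i m =
     (case doc_of m i of
        None \<Rightarrow> nil
      | Some d \<Rightarrow> (case find_field d name of None \<Rightarrow> nil | Some fl \<Rightarrow> htail fl))"

definition set_value :: "'u obj \<Rightarrow> 'u obj \<Rightarrow> 'u obj \<Rightarrow> 'u obj" where
  "set_value name v d =
     Lst (map (\<lambda>fl. if hhead fl = name then hcons v name else fl) (elems d))"


section \<open>Terms and formulas\<close>

text \<open>The variables other than \<open>VLocal\<close> are the formal parameters of filters and daemons;
  \<open>VItem\<close> is the ID over which an instruction term iterates.\<close>

datatype var =
    VModel | VQueue | VDoc | VField | VValue | VTrans | VParams | VForm | VItem | VLocal nat

type_synonym 'u env = "var \<Rightarrow> 'u obj"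

text \<open>Document terms. \<open>CondT\<close> lists the pairs \<open>[\<theta>\<^sub>i, q\<^sub>i]\<close> followed by the default.
  \<open>SearchT x \<phi> t\<close> is the first element \<open>x\<close> of \<open>t\<close> satisfying \<open>\<phi>\<close>, or \<open>t\<close> itself if there
  is none. \<open>RecT f g b h t\<close> is \<open>g(t)\<close> where \<open>g(\<langle>\<rangle>) = f\<close> and \<open>g(cons(\<alpha>, b)) = h(g(\<alpha>), b)\<close>; the
  variables \<open>g\<close> (for the value \<open>g(\<alpha>)\<close>) and \<open>b\<close> are bound in \<open>h\<close>. The last two accessors take
  the ID and the model as their last two arguments.\<close>

datatype 'u trm =
    Var var
  | Const 'u
  | EmptyT
  | ConsT "'u trm" "'u trm"
  | ConcT "'u trm" "'u trm"
  | HeadT "'u trm"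
  | TailT "'u trm"
  | CondT "('u fml \<times> 'u trm) list" "'u trm"
  | SearchT var "'u fml" "'u trm"
  | RecT "'u trm" var var "'u trm" "'u trm"
  | PlusT "'u trm" "'u trm"
  | MinusT "'u trm" "'u trm"
  | TimesT "'u trm" "'u trm"
  | DivT "'u trm" "'u trm"
  | LatestIDT "'u trm"
  | DocByIDT "'u trm" "'u trm"
  | FieldValueT "'u trm" "'u trm" "'u trm"
and 'u fml =
    EqF "'u trm" "'u trm"
  | LessF "'u trm" "'u trm"
  | MemF "'u trm" "'u trm"
  | SegF "'u trm" "'u trm"
  | NotF "'u fml"
  | AndF "'u fml" "'u fml"
  | OrF "'u fml" "'u fml"
  | AllMemF var "'u trm" "'u fml"
  | ExMemF var "'u trm" "'u fml"
  | AllSegF var "'u trm" "'u fml"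
  | ExSegF var "'u trm" "'u fml"

primrec eval :: "'u trm \<Rightarrow> 'u env \<Rightarrow> 'u obj" and sat :: "'u fml \<Rightarrow> 'u env \<Rightarrow> bool" where
  "eval (Var x) = (\<lambda>e. e x)"
| "eval (Const a) = (\<lambda>e. Ur a)"
| "eval EmptyT = (\<lambda>e. nil)"
| "eval (ConsT s t) = (\<lambda>e. hcons (eval s e) (eval t e))"
| "eval (ConcT s t) = (\<lambda>e. hconc (eval s e) (eval t e))"
| "eval (HeadT t) = (\<lambda>e. hhead (eval t e))"
| "eval (TailT t) = (\<lambda>e. htail (eval t e))"
| "eval (CondT bs t) = (\<lambda>e.
     case find (\<lambda>(c, q). c e) (map (map_prod sat eval) bs) of
       Some (c, q) \<Rightarrow> q e
     | None \<Rightarrow> eval t e)"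
| "eval (SearchT x \<phi> t) = (\<lambda>e.
     case find (\<lambda>a. sat \<phi> (e(x := a))) (elems (eval t e)) of
       Some a \<Rightarrow> a
     | None \<Rightarrow> eval t e)"
| "eval (RecT f x y h t) = (\<lambda>e.
     foldl (\<lambda>g b. eval h (e(x := g, y := b))) (eval f e) (elems (eval t e)))"
| "eval (PlusT s t) = (\<lambda>e. num_op (+) (eval s e) (eval t e))"
| "eval (MinusT s t) = (\<lambda>e. num_op (-) (eval s e) (eval t e))"
| "eval (TimesT s t) = (\<lambda>e. num_op (*) (eval s e) (eval t e))"
| "eval (DivT s t) = (\<lambda>e. num_op (div) (eval s e) (eval t e))"
| "eval (LatestIDT m) = (\<lambda>e. num (latest_id (elems (eval m e))))"
| "eval (DocByIDT i m) = (\<lambda>e.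
     case doc_of (elems (eval m e)) (eval i e) of Some d \<Rightarrow> d | None \<Rightarrow> nil)"
| "eval (FieldValueT f i m) = (\<lambda>e. field_value (eval f e) (eval i e) (elems (eval m e)))"
| "sat (EqF s t) = (\<lambda>e. eval s e = eval t e)"
| "sat (LessF s t) = (\<lambda>e. num_less (eval s e) (eval t e))"
| "sat (MemF s t) = (\<lambda>e. eval s e \<in> set (elems (eval t e)))"
| "sat (SegF s t) = (\<lambda>e. init_seg (eval s e) (eval t e))"
| "sat (NotF \<phi>) = (\<lambda>e. \<not> sat \<phi> e)"
| "sat (AndF \<phi> \<psi>) = (\<lambda>e. sat \<phi> e \<and> sat \<psi> e)"
| "sat (OrF \<phi> \<psi>) = (\<lambda>e. sat \<phi> e \<or> sat \<psi> e)"
| "sat (AllMemF x t \<phi>) = (\<lambda>e. \<forall>a\<in>set (elems (eval t e)). sat \<phi> (e(x := a)))"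
| "sat (ExMemF x t \<phi>) = (\<lambda>e. \<exists>a\<in>set (elems (eval t e)). sat \<phi> (e(x := a)))"
| "sat (AllSegF x t \<phi>) = (\<lambda>e. \<forall>a. init_seg a (eval t e) \<longrightarrow> sat \<phi> (e(x := a)))"
| "sat (ExSegF x t \<phi>) = (\<lambda>e. \<exists>a. init_seg a (eval t e) \<and> sat \<phi> (e(x := a)))"

primrec fvt :: "'u trm \<Rightarrow> var set" and fvf :: "'u fml \<Rightarrow> var set" where
  "fvt (Var x) = {x}"
| "fvt (Const a) = {}"
| "fvt EmptyT = {}"
| "fvt (ConsT s t) = fvt s \<union> fvt t"
| "fvt (ConcT s t) = fvt s \<union> fvt t"
| "fvt (HeadT t) = fvt t"
| "fvt (TailT t) = fvt t"
| "fvt (CondT bs t) = (\<Union>(C, Q)\<in>set (map (map_prod fvf fvt) bs). C \<union> Q) \<union> fvt t"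
| "fvt (SearchT x \<phi> t) = (fvf \<phi> - {x}) \<union> fvt t"
| "fvt (RecT f x y h t) = fvt f \<union> (fvt h - {x, y}) \<union> fvt t"
| "fvt (PlusT s t) = fvt s \<union> fvt t"
| "fvt (MinusT s t) = fvt s \<union> fvt t"
| "fvt (TimesT s t) = fvt s \<union> fvt t"
| "fvt (DivT s t) = fvt s \<union> fvt t"
| "fvt (LatestIDT m) = fvt m"
| "fvt (DocByIDT i m) = fvt i \<union> fvt m"
| "fvt (FieldValueT f i m) = fvt f \<union> fvt i \<union> fvt m"
| "fvf (EqF s t) = fvt s \<union> fvt t"
| "fvf (LessF s t) = fvt s \<union> fvt t"
| "fvf (MemF s t) = fvt s \<union> fvt t"
| "fvf (SegF s t) = fvt s \<union> fvt t"
| "fvf (NotF \<phi>) = fvf \<phi>"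
| "fvf (AndF \<phi> \<psi>) = fvf \<phi> \<union> fvf \<psi>"
| "fvf (OrF \<phi> \<psi>) = fvf \<phi> \<union> fvf \<psi>"
| "fvf (AllMemF x t \<phi>) = fvt t \<union> (fvf \<phi> - {x})"
| "fvf (ExMemF x t \<phi>) = fvt t \<union> (fvf \<phi> - {x})"
| "fvf (AllSegF x t \<phi>) = fvt t \<union> (fvf \<phi> - {x})"
| "fvf (ExSegF x t \<phi>) = fvt t \<union> (fvf \<phi> - {x})"

text \<open>Boolean combinations of comparisons; inside the compared terms any formula may occur.\<close>

fun comparison_comb :: "'u fml \<Rightarrow> bool" where
  "comparison_comb (EqF s t) = True"
| "comparison_comb (LessF s t) = True"
| "comparison_comb (NotF \<phi>) = comparison_comb \<phi>"
| "comparison_comb (AndF \<phi> \<psi>) = (comparison_comb \<phi> \<and> comparison_comb \<psi>)"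
| "comparison_comb (OrF \<phi> \<psi>) = (comparison_comb \<phi> \<and> comparison_comb \<psi>)"
| "comparison_comb _ = False"


section \<open>Document theories\<close>

text \<open>The instruction terms from which queue extensions are concatenated:
  \<^item> \<open>SetFieldI fieldName value\<close>: \<open>\<langle>value, fieldName, docID, SetField\<rangle>\<close> for the current \<open>docID\<close>;
  \<^item> \<open>TransForI filter form filterParams params transName\<close>: \<open>\<langle>params, ID, transName\<rangle>\<close> for every
    \<open>ID\<close> in the result of the filter on \<open>form\<close>;
  \<^item> \<open>CreateI form\<close>: \<open>\<langle>form, CreateDoc\<rangle>\<close>;
  \<^item> \<open>CreateForI filter form filterParams\<close>: \<open>\<langle>form, CreateDoc\<rangle>\<close> for every ID in the result of the
    filter on \<open>form\<close>.\<close>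

datatype 'u instr_term =
    SetFieldI 'u "'u trm"
  | TransForI 'u 'u "'u trm" "'u trm" 'u
  | CreateI 'u
  | CreateForI 'u 'u "'u trm"

text \<open>A branch \<open>[\<theta>, conc(queue, instr)]\<close> of a daemon: \<open>\<theta>\<close> says that the document \<open>docID\<close> has form
  \<open>b_form\<close>, that the changed field (in \<open>SetFieldTrigger\<close>) or the transaction (in \<open>ExecTrans\<close>)
  is \<open>b_name\<close>, and that \<open>b_cond\<close> holds; \<open>b_ext\<close> is \<open>instr\<close>.\<close>

record 'u branch =
  b_form :: 'u
  b_name :: 'u
  b_cond :: "'u fml"
  b_ext :: "'u instr_term list"

text \<open>\<open>cardinality T f\<close> is the set of admissible lengths of values of the field \<open>f\<close>. A blank
  document is given by the names and default values of its fields. \<open>situation T model instr\<close>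
  is the first component of the version created by the instruction \<open>instr\<close>; it is left
  arbitrary.\<close>

record 'u doc_theory =
  field_names :: "'u set"
  form_names :: "'u set"
  filter_names :: "'u set"
  trans_names :: "'u set"
  create_doc :: 'u
  set_field :: 'u
  cardinality :: "'u \<Rightarrow> nat set"
  blank :: "'u \<Rightarrow> ('u \<times> 'u obj list) list"
  filter_cond :: "'u \<Rightarrow> 'u fml"
  situation :: "'u obj list \<Rightarrow> 'u obj \<Rightarrow> 'u obj"
  trigger_branches :: "'u branch list"
  trans_branches :: "'u branch list"

primrec wf_instr_term :: "'u doc_theory \<Rightarrow> var set \<Rightarrow> 'u instr_term \<Rightarrow> bool" where
  "wf_instr_term T V (SetFieldI f v) \<longleftrightarrow> f \<in> field_names T \<and> fvt v \<subseteq> V"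
| "wf_instr_term T V (TransForI flt g fp p t) \<longleftrightarrow>
     flt \<in> filter_names T \<and> g \<in> form_names T \<and> t \<in> trans_names T \<and>
     fvt fp \<subseteq> V \<and> fvt p \<subseteq> insert VItem V"
| "wf_instr_term T V (CreateI g) \<longleftrightarrow> g \<in> form_names T"
| "wf_instr_term T V (CreateForI flt g fp) \<longleftrightarrow>
     flt \<in> filter_names T \<and> g \<in> form_names T \<and> fvt fp \<subseteq> V"

primrec creates :: "'u instr_term \<Rightarrow> bool" where
  "creates (SetFieldI f v) = False"
| "creates (TransForI flt g fp p t) = False"
| "creates (CreateI g) = True"
| "creates (CreateForI flt g fp) = True"

definition wf_branch :: "'u doc_theory \<Rightarrow> 'u set \<Rightarrow> var set \<Rightarrow> 'u branch \<Rightarrow> bool" where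
  "wf_branch T N V b \<longleftrightarrow>
     b_form b \<in> form_names T \<and> b_name b \<in> N \<and>
     comparison_comb (b_cond b) \<and> fvf (b_cond b) \<subseteq> V \<and>
     (\<forall>i\<in>set (b_ext b). wf_instr_term T V i)"

definition document_theory :: "'u doc_theory \<Rightarrow> bool" where
  "document_theory T \<longleftrightarrow>
     finite (field_names T) \<and> finite (form_names T) \<and>
     finite (filter_names T) \<and> finite (trans_names T) \<and>
     form_names T \<noteq> {} \<and>
     field_names T \<inter> form_names T = {} \<and> field_names T \<inter> filter_names T = {} \<and>
     field_names T \<inter> trans_names T = {} \<and> form_names T \<inter> filter_names T = {} \<and>
     form_names T \<inter> trans_names T = {} \<and> filter_names T \<inter> trans_names T = {} \<and>
     create_doc T \<noteq> set_field T \<and>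
     {create_doc T, set_field T} \<inter>
       (field_names T \<union> form_names T \<union> filter_names T \<union> trans_names T) = {} \<and>
     (\<forall>g\<in>form_names T. fst ` set (blank T g) \<subseteq> field_names T) \<and>
     (\<forall>n\<in>filter_names T. comparison_comb (filter_cond T n) \<and>
        fvf (filter_cond T n) \<subseteq> {VForm, VModel, VParams, VDoc}) \<and>
     (\<forall>b\<in>set (trigger_branches T).
        wf_branch T (field_names T) {VDoc, VField, VValue, VQueue, VModel} b \<and>
        (\<forall>i\<in>set (b_ext b). \<not> creates i)) \<and>
     (\<forall>b\<in>set (trans_branches T).
        wf_branch T (trans_names T) {VTrans, VDoc, VParams, VQueue, VModel} b)"


section \<open>Filters and daemons\<close>

text \<open>In a filter condition \<open>VDoc\<close> is the ID of the document being tested.\<close>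

definition docs_by_filter ::
  "'u doc_theory \<Rightarrow> 'u \<Rightarrow> 'u \<Rightarrow> 'u obj list \<Rightarrow> 'u obj \<Rightarrow> 'u obj list" where
  "docs_by_filter T flt g m p =
     filter (\<lambda>i. form_of m i = Some (Ur g) \<and>
         sat (filter_cond T flt)
           ((\<lambda>_. nil)(VForm := Ur g, VModel := Lst m, VParams := p, VDoc := i)))
       (doc_ids m)"

text \<open>The iterated instructions are \<open>Rec\<close>-terms with initial value \<open>\<langle>\<rangle>\<close> and step
  \<open>cons(g, instruction)\<close>, evaluated as in \<open>eval\<close>.\<close>

primrec instrs :: "'u doc_theory \<Rightarrow> 'u env \<Rightarrow> 'u instr_term \<Rightarrow> 'u obj list" where
  "instrs T e (SetFieldI f v) = [Lst [eval v e, Ur f, e VDoc, Ur (set_field T)]]"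
| "instrs T e (TransForI flt g fp p t) =
     foldl (\<lambda>acc i. acc @ [Lst [eval p (e(VItem := i)), i, Ur t]]) []
       (docs_by_filter T flt g (elems (e VModel)) (eval fp e))"
| "instrs T e (CreateI g) = [Lst [Ur g, Ur (create_doc T)]]"
| "instrs T e (CreateForI flt g fp) =
     foldl (\<lambda>acc i. acc @ [Lst [Ur g, Ur (create_doc T)]]) []
       (docs_by_filter T flt g (elems (e VModel)) (eval fp e))"

definition branch_cond :: "'u obj \<Rightarrow> 'u env \<Rightarrow> 'u branch \<Rightarrow> bool" where
  "branch_cond name e b \<longleftrightarrow>
     form_of (elems (e VModel)) (e VDoc) = Some (Ur (b_form b)) \<and>
     name = Ur (b_name b) \<and> sat (b_cond b) e"

definition run_branches ::
  "'u doc_theory \<Rightarrow> 'u branch list \<Rightarrow> 'u obj \<Rightarrow> 'u env \<Rightarrow> 'u obj list \<Rightarrow> 'u obj list" where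
  "run_branches T bs name e queue =
     (case find (branch_cond name e) bs of
        Some b \<Rightarrow> queue @ concat (map (instrs T e) (b_ext b))
      | None \<Rightarrow> queue)"

definition set_field_trigger ::
  "'u doc_theory \<Rightarrow> 'u obj \<Rightarrow> 'u obj \<Rightarrow> 'u obj \<Rightarrow> 'u obj list \<Rightarrow> 'u obj list \<Rightarrow> 'u obj list" where
  "set_field_trigger T docID fieldName value queue model =
     run_branches T (trigger_branches T) fieldName
       ((\<lambda>_. nil)(VDoc := docID, VField := fieldName, VValue := value,
                  VQueue := Lst queue, VModel := Lst model))
       queue"

definition exec_trans ::
  "'u doc_theory \<Rightarrow> 'u obj \<Rightarrow> 'u obj \<Rightarrow> 'u obj \<Rightarrow> 'u obj list \<Rightarrow> 'u obj list \<Rightarrow> 'u obj list" where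
  "exec_trans T transName docID params queue model =
     run_branches T (trans_branches T) transName
       ((\<lambda>_. nil)(VTrans := transName, VDoc := docID, VParams := params,
                  VQueue := Lst queue, VModel := Lst model))
       queue"


section \<open>Update and the chase\<close>

definition blank_doc :: "'u doc_theory \<Rightarrow> 'u \<Rightarrow> 'u obj" where
  "blank_doc T g = Lst (map (\<lambda>(f, v). hcons (Lst v) (Ur f)) (blank T g))"

definition respects_cardinality :: "'u doc_theory \<Rightarrow> 'u \<Rightarrow> 'u obj \<Rightarrow> bool" where
  "respects_cardinality T f v \<longleftrightarrow> is_list v \<and> length (elems v) \<in> cardinality T f"

type_synonym 'u state = "'u obj list \<times> 'u obj list"

definition do_create ::
  "'u doc_theory \<Rightarrow> 'u obj list \<Rightarrow> 'u \<Rightarrow> 'u obj \<Rightarrow> 'u obj list \<Rightarrow> 'u obj list \<Rightarrow> 'u state" where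
  "do_create T im g instr model rest =
     (if g \<in> form_names T
      then (model @ [Lst [situation T model instr, Ur g, blank_doc T g,
                          num (Suc (latest_id model))]], rest)
      else (im, []))"

definition do_set_field ::
  "'u doc_theory \<Rightarrow> 'u obj list \<Rightarrow> 'u obj \<Rightarrow> 'u \<Rightarrow> 'u obj \<Rightarrow>
   'u obj \<Rightarrow> 'u obj list \<Rightarrow> 'u obj list \<Rightarrow> 'u state" where
  "do_set_field T im v f i instr model rest =
     (case last_version model i of
        None \<Rightarrow> (im, [])
      | Some (s, g, d, j) \<Rightarrow>
          if f \<in> field_names T \<and> find_field d (Ur f) \<noteq> None \<and> respects_cardinality T f v
          then (model @ [Lst [situation T model instr, g, set_value (Ur f) v d, i]],
                set_field_trigger T i (Ur f) v rest model)
          else (im, []))"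

definition do_trans ::
  "'u doc_theory \<Rightarrow> 'u obj list \<Rightarrow> 'u obj \<Rightarrow> 'u obj \<Rightarrow> 'u \<Rightarrow>
   'u obj list \<Rightarrow> 'u obj list \<Rightarrow> 'u state" where
  "do_trans T im p i t model rest =
     (if t \<in> trans_names T then (model, exec_trans T (Ur t) i p rest model) else (im, []))"

text \<open>One unfolding of \<open>Update(im, model, queue)\<close> for a non-empty queue. The first instruction is
  \<open>head(queue)\<close> and the remaining queue is \<open>tail(queue)\<close>, that is, instructions are taken from
  the same end at which \<open>cons\<close> and \<open>conc\<close> add them. When \<open>Update\<close> returns the initial model
  \<open>im\<close>, nothing remains to be processed, which is expressed by the empty queue.\<close>

definition update_step ::
  "'u doc_theory \<Rightarrow> 'u obj list \<Rightarrow> 'u state \<Rightarrow> 'u state" where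
  "update_step T im s =
     (let model = fst s; instr = last (snd s); rest = butlast (snd s) in
      case elems instr of
        [Ur g, Ur c] \<Rightarrow>
          if c = create_doc T then do_create T im g instr model rest else (im, [])
      | [v, Ur f, i, Ur c] \<Rightarrow>
          if c = set_field T then do_set_field T im v f i instr model rest else (im, [])
      | [p, i, Ur t] \<Rightarrow> do_trans T im p i t model rest
      | _ \<Rightarrow> (im, []))"

definition chase_step :: "'u doc_theory \<Rightarrow> 'u obj list \<Rightarrow> 'u state \<Rightarrow> 'u state \<Rightarrow> bool" where
  "chase_step T im s s' \<longleftrightarrow> snd s \<noteq> [] \<and> s' = update_step T im s"

text \<open>A chase sequence \<open>s 0, s 1, \<dots>\<close> consists of \<open>n \<le> \<infinity>\<close> steps, so its last state, if any, is
  \<open>s n\<close>. The initial model of \<open>Update\<close> is the model at which the sequence starts.\<close>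

definition chase_sequence ::
  "'u doc_theory \<Rightarrow> 'u obj list \<Rightarrow> 'u obj list \<Rightarrow> (nat \<Rightarrow> 'u state) \<Rightarrow> enat \<Rightarrow> bool" where
  "chase_sequence T model queue s n \<longleftrightarrow>
     s 0 = (model, queue) \<and> (\<forall>i. enat i < n \<longrightarrow> chase_step T model (s i) (s (Suc i)))"

definition terminating :: "(nat \<Rightarrow> 'u state) \<Rightarrow> enat \<Rightarrow> bool" where
  "terminating s n \<longleftrightarrow> (\<exists>k\<ge>1. n = enat k \<and> snd (s k) = [])"


section \<open>Local simplicity\<close>

text \<open>\<open>target T g i\<close> is the pair \<open>(form', name')\<close> such that \<open>i\<close>, in a branch whose condition is
  for the form \<open>g\<close>, is a \<open>(form', name')\<close>-instruction.\<close>

primrec target :: "'u doc_theory \<Rightarrow> 'u \<Rightarrow> 'u instr_term \<Rightarrow> 'u \<times> 'u" where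
  "target T g (SetFieldI f v) = (g, f)"
| "target T g (TransForI flt h fp p t) = (h, t)"
| "target T g (CreateI h) = (h, create_doc T)"
| "target T g (CreateForI flt h fp) = (h, create_doc T)"

definition dep_vertices :: "'u doc_theory \<Rightarrow> ('u \<times> 'u) set" where
  "dep_vertices T =
     form_names T \<times> (field_names T \<union> trans_names T \<union> {create_doc T})"

definition dep_edges :: "'u doc_theory \<Rightarrow> (('u \<times> 'u) \<times> ('u \<times> 'u)) set" where
  "dep_edges T =
     {(u, v) \<in> dep_vertices T \<times> dep_vertices T.
        \<exists>b\<in>set (trigger_branches T) \<union> set (trans_branches T).
          u = (b_form b, b_name b) \<and> v \<in> target T (b_form b) ` set (b_ext b)}"

definition locally_simple :: "'u doc_theory \<Rightarrow> bool" where
  "locally_simple T \<longleftrightarrow> acyclic (dep_edges T)"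

end

theory Submission
  imports Defs
begin

text \<open>Instructions are taken from the end at which daemons append, so the queue is a stack. A
  document keeps its form in all later models, and a daemon emits instructions only for documents
  whose form it has just tested. Hence an emitted instruction has a fixed vertex of the dependency
  graph, and executing it emits only instructions at successor vertices. By well-founded induction
  along this finite acyclic graph, every emitted instruction is eventually consumed whenever the
  queue below it is; the instructions of the initial queue follow, since after one step they have
  been replaced by emitted ones.\<close>

section \<open>Halting runs and terminating chase sequences\<close>

definition halts :: "'u doc_theory \<Rightarrow> 'u obj list \<Rightarrow> 'u state \<Rightarrow> bool" where
  "halts T im s \<longleftrightarrow> (\<exists>k. snd ((update_step T im ^^ k) s) = [])"

lemma halts_Nil [simp]: "halts T im (m, [])"
  unfolding halts_def by (rule exI[of _ 0]) simp

lemma halts_step: "halts T im (update_step T im s) \<Longrightarrow> halts T im s"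
  unfolding halts_def by (metis comp_apply funpow_Suc_right)

lemma halts_imp_terminating_chase:
  assumes "halts T model (model, queue)" and "queue \<noteq> []"
  shows "\<exists>s n. chase_sequence T model queue s n \<and> terminating s n"
proof -
  define s where "s i = (update_step T model ^^ i) (model, queue)" for i
  \<comment> \<open>Minimality of \<open>k\<close> keeps all earlier queues non-empty, as
    \<open>chase_step\<close> requires.\<close>
  define k where "k = (LEAST k. snd (s k) = [])"
  have "\<exists>k. snd (s k) = []"
    using assms(1) by (simp add: halts_def s_def)
  then have k: "snd (s k) = []"
    unfolding k_def by (rule LeastI_ex)
  have less: "snd (s i) \<noteq> []" if "i < k" for i
    using that not_less_Least unfolding k_def by blast
  have "k \<noteq> 0"
    using k assms(2) by (auto simp: s_def intro: gr0I)
  moreover have "chase_sequence T model queue s (enat k)"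
    using less by (auto simp: chase_sequence_def chase_step_def s_def)
  ultimately show ?thesis
    using k unfolding terminating_def by (metis One_nat_def Suc_leI neq0_conv)
qed


section \<open>Forms of documents\<close>

text \<open>Of a model, only the forms matter for placing instructions in the graph; field values
  may change freely.\<close>

definition preserves_forms :: "'u obj list \<Rightarrow> 'u obj list \<Rightarrow> bool" where
  "preserves_forms m m' \<longleftrightarrow> (\<forall>i g. form_of m i = Some g \<longrightarrow> form_of m' i = Some g)"

lemma preserves_forms_refl [simp]: "preserves_forms m m"
  by (simp add: preserves_forms_def)

lemma preserves_forms_trans:
  "preserves_forms m m' \<Longrightarrow> preserves_forms m' m'' \<Longrightarrow> preserves_forms m m''"
  by (simp add: preserves_forms_def)

lemma form_of_snoc:
  "form_of (m @ [Lst [s, f, d, i]]) j = (if j = i then Some f else form_of m j)"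
  by (simp add: form_of_def last_version_def entries_def map_filter_def)

lemma form_of_eq_None_iff: "form_of m i = None \<longleftrightarrow> i \<notin> set (doc_ids m)"
  by (force simp: form_of_def last_version_def doc_ids_def find_None_iff)

lemma inj_num: "inj num"
  by (rule injI) (simp add: num_def)

text \<open>Injectivity of \<open>num\<close> makes the set under \<open>Max\<close> finite, so
  \<open>latest_id\<close> bounds every numeric ID.\<close>

lemma form_of_fresh_id: "form_of m (num (Suc (latest_id m))) = None"
proof -
  have "finite {n. num n \<in> set (doc_ids m)}"
    using finite_vimageI[OF finite_set inj_num] by (simp add: vimage_def)
  then have "n \<le> latest_id m" if "num n \<in> set (doc_ids m)" for n
    using that by (simp add: latest_id_def)
  then show ?thesis
    unfolding form_of_eq_None_iff using not_less_eq_eq by blast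
qed

lemma preserves_forms_create:
  "preserves_forms m (m @ [Lst [s, f, d, num (Suc (latest_id m))]])"
  using form_of_fresh_id[of m] by (auto simp: preserves_forms_def form_of_snoc)

lemma preserves_forms_update:
  "form_of m i = Some g \<Longrightarrow> preserves_forms m (m @ [Lst [s, g, d, i]])"
  by (simp add: preserves_forms_def form_of_snoc)


section \<open>Vertices of instructions\<close>

text \<open>The model is a parameter because field and transaction instructions name only the ID of
  a document, not its form.\<close>

inductive at_vertex :: "'u doc_theory \<Rightarrow> 'u obj list \<Rightarrow> 'u \<times> 'u \<Rightarrow> 'u obj \<Rightarrow> bool"
  for T m where
  create: "at_vertex T m (g, create_doc T) (Lst [Ur g, Ur (create_doc T)])"
| set_field: "form_of m i = Some (Ur g) \<Longrightarrow>
    at_vertex T m (g, f) (Lst [v, Ur f, i, Ur (set_field T)])"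
| trans: "form_of m i = Some (Ur g) \<Longrightarrow> at_vertex T m (g, t) (Lst [p, i, Ur t])"

lemma at_vertex_mono: "at_vertex T m u x \<Longrightarrow> preserves_forms m m' \<Longrightarrow> at_vertex T m' u x"
  by (auto simp: preserves_forms_def elim!: at_vertex.cases intro: at_vertex.intros)

text \<open>The three shapes have lengths 2, 4 and 3, and \<open>form_of\<close> is a
  function.\<close>

lemma at_vertex_unique: "at_vertex T m u x \<Longrightarrow> at_vertex T m u' x \<Longrightarrow> u = u'"
  by (auto elim!: at_vertex.cases)

lemma foldl_snoc_map: "foldl (\<lambda>acc i. acc @ [f i]) xs ys = xs @ map f ys"
  by (induction ys arbitrary: xs) auto

text \<open>A field instruction addresses the document already known to have form \<open>g\<close>;
  a filter returns only IDs of documents of the form it is applied to.\<close>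

lemma instrs_at_target:
  assumes "y \<in> set (instrs T e i)"
    and "form_of (elems (e VModel)) (e VDoc) = Some (Ur g)"
  shows "at_vertex T (elems (e VModel)) (target T g i) y"
  using assms by (cases i)
    (auto simp: foldl_snoc_map docs_by_filter_def intro: at_vertex.intros)

text \<open>\<open>dep_edges\<close> is restricted to \<open>dep_vertices\<close>, so
  well-formedness of the branch must place both ends there.\<close>

lemma target_in_dep_edges:
  assumes "document_theory T"
    and "b \<in> set (trigger_branches T) \<union> set (trans_branches T)"
    and "i \<in> set (b_ext b)"
  shows "((b_form b, b_name b), target T (b_form b) i) \<in> dep_edges T"
proof -
  have "wf_branch T (field_names T) {VDoc, VField, VValue, VQueue, VModel} b \<or>
      wf_branch T (trans_names T) {VTrans, VDoc, VParams, VQueue, VModel} b"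
    using assms(1,2) by (auto simp only: document_theory_def Un_iff)
  then obtain N V where N: "N \<subseteq> field_names T \<union> trans_names T" and b: "wf_branch T N V b"
    by (meson Un_upper1 Un_upper2)
  then have "(b_form b, b_name b) \<in> dep_vertices T"
    by (auto simp: wf_branch_def dep_vertices_def)
  moreover have "target T (b_form b) i \<in> dep_vertices T"
    using b assms(3) by (cases i) (auto simp: wf_branch_def dep_vertices_def)
  ultimately show ?thesis
    using assms(2,3) by (auto simp: dep_edges_def)
qed

lemma wf_converse_dep_edges:
  assumes "document_theory T" and "locally_simple T"
  shows "wf ((dep_edges T)\<inverse>)"
proof -
  have "finite (dep_vertices T)"
    using assms(1) by (simp add: document_theory_def dep_vertices_def)
  moreover have "dep_edges T \<subseteq> dep_vertices T \<times> dep_vertices T"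
    by (auto simp: dep_edges_def)
  ultimately have "finite (dep_edges T)"
    by (meson finite_SigmaI finite_subset)
  then show ?thesis
    using assms(2) by (simp add: locally_simple_def finite_acyclic_wf_converse)
qed

text \<open>Case \<open>none\<close> also covers instructions without a vertex, such as a
  transaction on an unknown document.\<close>

inductive emits :: "'u doc_theory \<Rightarrow> 'u obj list \<Rightarrow> 'u obj \<Rightarrow> 'u obj list \<Rightarrow> bool"
  for T m x where
  none: "emits T m x []"
| some: "at_vertex T m u x \<Longrightarrow>
    (\<And>y. y \<in> set ys \<Longrightarrow> \<exists>w. (u, w) \<in> dep_edges T \<and> at_vertex T m w y) \<Longrightarrow> emits T m x ys"

text \<open>A branch fires only after its condition has tested form and name, which fixes the source
  vertex of everything it emits.\<close>

lemma emits_run_branches: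
  assumes "document_theory T"
    and bs: "set bs \<subseteq> set (trigger_branches T) \<union> set (trans_branches T)"
    and m: "elems (e VModel) = m"
    and x: "\<And>g f. form_of m (e VDoc) = Some (Ur g) \<Longrightarrow> name = Ur f \<Longrightarrow> at_vertex T m (g, f) x"
  shows "\<exists>ys. run_branches T bs name e q = q @ ys \<and> emits T m x ys"
proof (cases "find (branch_cond name e) bs")
  case None
  then show ?thesis by (auto simp: run_branches_def intro: emits.none)
next
  case (Some b)
  then have "b \<in> set bs" and cond: "branch_cond name e b"
    by (auto simp: find_Some_iff)
  then have b: "b \<in> set (trigger_branches T) \<union> set (trans_branches T)"
    using bs by blast
  have "emits T m x (concat (map (instrs T e) (b_ext b)))"
  proof (rule emits.some)
    show "at_vertex T m (b_form b, b_name b) x"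
      using cond by (intro x) (auto simp: branch_cond_def m)
  next
    fix y assume "y \<in> set (concat (map (instrs T e) (b_ext b)))"
    then obtain i where i: "i \<in> set (b_ext b)" and y: "y \<in> set (instrs T e i)"
      by auto
    have "at_vertex T m (target T (b_form b) i) y"
      using instrs_at_target[OF y] cond by (auto simp: branch_cond_def m)
    then show "\<exists>w. ((b_form b, b_name b), w) \<in> dep_edges T \<and> at_vertex T m w y"
      using target_in_dep_edges[OF assms(1) b i] by blast
  qed
  then show ?thesis using Some by (auto simp: run_branches_def)
qed


section \<open>Termination\<close>

lemma do_create_cases:
  "do_create T im g x m q = (im, []) \<or>
   (\<exists>m' ys. do_create T im g x m q = (m', q @ ys) \<and> preserves_forms m m' \<and> emits T m x ys)"
  using preserves_forms_create[of m] emits.none[of T m x] by (auto simp: do_create_def)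

lemma do_set_field_cases:
  assumes "document_theory T" and x: "x = Lst [v, Ur f, i, Ur (set_field T)]"
  shows "do_set_field T im v f i x m q = (im, []) \<or>
   (\<exists>m' ys. do_set_field T im v f i x m q = (m', q @ ys) \<and>
      preserves_forms m m' \<and> emits T m x ys)"
proof (cases "last_version m i")
  case None
  then show ?thesis by (simp add: do_set_field_def)
next
  case (Some r)
  obtain s g d j where r: "r = (s, g, d, j)" by (cases r)
  have "form_of m i = Some g"
    using Some by (simp add: form_of_def r)
  note pres = preserves_forms_update[OF this, of "situation T m x" "set_value (Ur f) v d"]
  \<comment> \<open>The trigger reads the model \<open>m\<close> before the update, so vertices are
    taken in \<open>m\<close>.\<close>
  have "\<exists>ys. set_field_trigger T i (Ur f) v q m = q @ ys \<and> emits T m x ys"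
    unfolding set_field_trigger_def
    by (rule emits_run_branches[OF assms(1)]) (auto simp: x intro: at_vertex.set_field)
  then show ?thesis using pres Some by (auto simp: do_set_field_def r)
qed

lemma do_trans_cases:
  assumes "document_theory T" and x: "x = Lst [p, i, Ur t]"
  shows "do_trans T im p i t m q = (im, []) \<or>
   (\<exists>m' ys. do_trans T im p i t m q = (m', q @ ys) \<and> preserves_forms m m' \<and> emits T m x ys)"
proof -
  have "\<exists>ys. exec_trans T (Ur t) i p q m = q @ ys \<and> emits T m x ys"
    unfolding exec_trans_def
    by (rule emits_run_branches[OF assms(1)]) (auto simp: x intro: at_vertex.trans)
  then show ?thesis by (auto simp: do_trans_def)
qed

lemma update_step_create:
  "elems x = [Ur g, Ur (create_doc T)] \<Longrightarrow>
    update_step T im (m, q @ [x]) = do_create T im g x m q"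
  by (simp add: update_step_def)

lemma update_step_set_field:
  "elems x = [v, Ur f, i, Ur (set_field T)] \<Longrightarrow>
    update_step T im (m, q @ [x]) = do_set_field T im v f i x m q"
  by (cases v; cases i) (simp_all add: update_step_def)

lemma update_step_trans:
  "elems x = [p, i, Ur t] \<Longrightarrow> update_step T im (m, q @ [x]) = do_trans T im p i t m q"
  by (cases p; cases i) (simp_all add: update_step_def)

lemma update_step_invalid:
  assumes "\<nexists>g. elems x = [Ur g, Ur (create_doc T)]"
    and "\<nexists>v f i. elems x = [v, Ur f, i, Ur (set_field T)]"
    and "\<nexists>p i t. elems x = [p, i, Ur t]"
  shows "update_step T im (m, q @ [x]) = (im, [])"
proof -
  \<comment> \<open>Valid instructions have length 2, 3 or 4; the last case collects all longer
    lists.\<close>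
  consider "elems x = []" | a where "elems x = [a]" | a b where "elems x = [a, b]"
    | a b c where "elems x = [a, b, c]" | a b c d where "elems x = [a, b, c, d]"
    | a b c d e r where "elems x = a # b # c # d # e # r"
    by (metis list.exhaust)
  then show ?thesis
  proof cases
    case 1
    then show ?thesis by (simp add: update_step_def)
  next
    case (2 a)
    then show ?thesis by (cases a) (simp_all add: update_step_def)
  next
    case (3 a b)
    then show ?thesis using assms(1) by (cases a; cases b) (simp_all add: update_step_def)
  next
    case (4 a b c)
    then show ?thesis using assms(3)
      by (cases a; cases b; cases c) (simp_all add: update_step_def)
  next
    case (5 a b c d)
    then show ?thesis using assms(2)
      by (cases a; cases b; cases c; cases d) (simp_all add: update_step_def)
  next
    case (6 a b c d e r)
    then show ?thesis
      by (cases a; cases b; cases c; cases d) (simp_all add: update_step_def)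
  qed
qed

text \<open>Falling back to \<open>im\<close> may lose forms, but it also empties the queue;
  otherwise \<open>q\<close> stays intact as the bottom of the stack.\<close>

lemma update_step_cases:
  assumes "document_theory T"
  shows "update_step T im (m, q @ [x]) = (im, []) \<or>
   (\<exists>m' ys. update_step T im (m, q @ [x]) = (m', q @ ys) \<and>
      preserves_forms m m' \<and> emits T m x ys)"
proof -
  consider (create) g where "elems x = [Ur g, Ur (create_doc T)]"
    | (set_field) v f i where "elems x = [v, Ur f, i, Ur (set_field T)]"
    | (trans) p i t where "elems x = [p, i, Ur t]"
    | (invalid) "update_step T im (m, q @ [x]) = (im, [])"
    by (metis update_step_invalid)
  then show ?thesis
  proof cases
    case create
    then show ?thesis by (simp add: update_step_create do_create_cases)
  next
    case (set_field v f i)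
    moreover from this have "x = Lst [v, Ur f, i, Ur (set_field T)]" by (cases x) auto
    ultimately show ?thesis
      using do_set_field_cases[OF assms] by (simp only: update_step_set_field)
  next
    case (trans p i t)
    moreover from this have "x = Lst [p, i, Ur t]" by (cases x) auto
    ultimately show ?thesis
      using do_trans_cases[OF assms] by (simp only: update_step_trans)
  next
    case invalid
    then show ?thesis by blast
  qed
qed

text \<open>The quantifier over \<open>m'\<close> is there because \<open>q\<close> is reached only
  after the instructions above it have changed the model.\<close>

definition persistently_halts :: "'u doc_theory \<Rightarrow> 'u obj list \<Rightarrow> 'u obj list \<Rightarrow> 'u obj list \<Rightarrow> bool"
  where "persistently_halts T im m q \<longleftrightarrow> (\<forall>m'. preserves_forms m m' \<longrightarrow> halts T im (m', q))"

lemma persistently_halts_mono: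
  "persistently_halts T im m q \<Longrightarrow> preserves_forms m m' \<Longrightarrow> persistently_halts T im m' q"
  unfolding persistently_halts_def by (blast intro: preserves_forms_trans)

text \<open>In the style of a Kripke logical relation: quantifying over all later models and all
  stacks below makes the property local to \<open>x\<close>, so the induction can run on vertices
  alone.\<close>

definition consumable :: "'u doc_theory \<Rightarrow> 'u obj list \<Rightarrow> 'u obj list \<Rightarrow> 'u obj \<Rightarrow> bool" where
  "consumable T im m x \<longleftrightarrow> (\<forall>m' q. preserves_forms m m' \<longrightarrow>
     persistently_halts T im m' q \<longrightarrow> persistently_halts T im m' (q @ [x]))"

lemma persistently_halts_append:
  assumes "persistently_halts T im m q" and "\<And>y. y \<in> set ys \<Longrightarrow> consumable T im m y"
  shows "persistently_halts T im m (q @ ys)"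
  using assms(2)
proof (induction ys rule: rev_induct)
  case Nil
  then show ?case using assms(1) by simp
next
  case (snoc y ys)
  then have "persistently_halts T im m (q @ ys)" and "consumable T im m y"
    by auto
  then show ?case
    unfolding consumable_def by (metis append_assoc preserves_forms_refl)
qed

text \<open>One step replaces \<open>x\<close> on top of \<open>q\<close> by emitted instructions,
  which are consumable by \<open>succ\<close>. If \<open>x\<close> never has a vertex,
  \<open>succ\<close> is vacuous.\<close>

lemma consumableI:
  assumes "document_theory T"
    and succ: "\<And>m' u w y. preserves_forms m m' \<Longrightarrow> at_vertex T m' u x \<Longrightarrow>
      (u, w) \<in> dep_edges T \<Longrightarrow> at_vertex T m' w y \<Longrightarrow> consumable T im m' y"
  shows "consumable T im m x"
proof -
  have "halts T im (m', q @ [x])"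
    if m': "preserves_forms m m'" and q: "persistently_halts T im m' q" for m' q
    using update_step_cases[OF assms(1), of im m' q x]
  proof (elim disjE exE conjE)
    assume "update_step T im (m', q @ [x]) = (im, [])"
    then show ?thesis by (simp add: halts_step)
  next
    fix m'' ys
    assume step: "update_step T im (m', q @ [x]) = (m'', q @ ys)"
      and m'': "preserves_forms m' m''" and ys: "emits T m' x ys"
    from ys have "consumable T im m' y" if "y \<in> set ys" for y
      using that by cases (auto dest: succ[OF m'])
    then have "persistently_halts T im m' (q @ ys)"
      by (rule persistently_halts_append[OF q])
    then show ?thesis
      using m'' step by (simp add: halts_step persistently_halts_def)
  qed
  \<comment> \<open>The halting just shown is applied at every model later than \<open>m'\<close>,
    where \<open>q\<close> still halts persistently.\<close>
  then have "persistently_halts T im m' (q @ [x])"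
    if "preserves_forms m m'" and "persistently_halts T im m' q" for m' q
    using that persistently_halts_mono preserves_forms_trans
    unfolding persistently_halts_def[of T im m' "q @ [x]"] by blast
  then show ?thesis
    by (simp add: consumable_def)
qed

lemma consumable_at_vertex:
  assumes "document_theory T" and "locally_simple T" and "at_vertex T m u x"
  shows "consumable T im m x"
  using wf_converse_dep_edges[OF assms(1,2)] assms(3)
proof (induction u arbitrary: m x rule: wf_induct_rule)
  case (less u)
  show ?case
  proof (rule consumableI[OF assms(1)])
    fix m' u' w y
    assume m': "preserves_forms m m'" and "at_vertex T m' u' x"
      and "(u', w) \<in> dep_edges T" and "at_vertex T m' w y"
    \<comment> \<open>The vertex \<open>u\<close> of \<open>x\<close> in \<open>m\<close> persists
      in \<open>m'\<close>, where it is unique.\<close>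
    moreover from this have "u' = u"
      using less.prems by (blast intro: at_vertex_unique at_vertex_mono)
    ultimately show "consumable T im m' y"
      using less.IH by blast
  qed
qed

text \<open>An empty queue admits no step, whereas a terminating sequence has at least one.\<close>

theorem theorem2:
  fixes T :: "'u doc_theory" and model queue :: "'u obj list"
  assumes "document_theory T"
    and "locally_simple T"
    and "queue \<noteq> []"
  shows "\<exists>s n. chase_sequence T model queue s n \<and> terminating s n"
proof -
  \<comment> \<open>Here \<open>x\<close> is arbitrary, possibly malformed or without a vertex; only
    the instructions it emits need the induction along the graph.\<close>
  have "consumable T model model x" for x
    using assms(1) by (rule consumableI) (rule consumable_at_vertex[OF assms(1,2)])
  then have "persistently_halts T model model ([] @ queue)"
    by (intro persistently_halts_append) (simp_all add: persistently_halts_def)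
  then have "halts T model (model, queue)"
    by (simp add: persistently_halts_def)
  then show ?thesis
    using assms(3) by (rule halts_imp_terminating_chase)
qed

end
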